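(* Let $p$ be a prime number, let $f:\mathbb{Z}_p\to\mathbb{Q}_p$ be an analytic function, and let $z_1,z_2\in\mathbb{Z}_p$ be two (not necessarily distinct) zeros of $f$ of multiplicities $\mu_1,\mu_2$, respectively. If $\gcd(\mu_1,\mu_2)=1$, then the set $R_f:=\{f(a)/f(b): a,b\in\mathbb{Z}^+,\ f(b)\neq 0\}$ is dense in $\mathbb{Q}_p$.
   Context: $\mathbb{Z}^+$ denotes the set of positive integers. A zero $z\in\mathbb{Z}_p$ of an analytic function $f:\mathbb{Z}_p\to\mathbb{Q}_p$ has multiplicity $\mu\ge 1$ if $f(X)=(X-z)^{\mu}g(X)$ for some analytic function $g:\mathbb{Z}_p\to\mathbb{Q}_p$ with $g(z)\neq 0$. *)

theory Defs
  imports "HOL-Analysis.Analysis" "Berlekamp_Zassenhaus.Finite_Field"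
begin

section \<open>The p-adic absolute value on the rationals\<close>

definition padic_abs :: "nat \<Rightarrow> rat \<Rightarrow> real" where
  "padic_abs p x =
     (if x = 0 then 0
      else real p powi (int (multiplicity (int p) (snd (quotient_of x)))
                        - int (multiplicity (int p) (fst (quotient_of x)))))"

context
  fixes p :: nat
  assumes p: "prime p"
begin

lemma padic_abs_frac:
  assumes "a \<noteq> 0" "b \<noteq> 0"
  shows "padic_abs p (of_int a / of_int b)
           = real p powi (int (multiplicity (int p) b) - int (multiplicity (int p) a))"
proof -
  define c d where "c = fst (quotient_of (of_int a / of_int b))"
    and "d = snd (quotient_of (of_int a / of_int b))"
  have q: "quotient_of (of_int a / of_int b) = (c, d)"
    by (simp add: c_def d_def)
  have d: "d > 0" using quotient_of_denom_pos[OF q] .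
  have e: "(of_int a / of_int b :: rat) = of_int c / of_int d"
    using quotient_of_div[OF q] .
  have c: "c \<noteq> 0" using e assms d by auto
  have "(of_int (a * d) :: rat) = of_int (c * b)"
    using e assms d by (simp add: field_simps)
  then have "a * d = c * b" using of_int_eq_iff by blast
  then have "multiplicity (int p) (a * d) = multiplicity (int p) (c * b)" by simp
  moreover have "prime_elem (int p)" using p by simp
  ultimately have "multiplicity (int p) a + multiplicity (int p) d
      = multiplicity (int p) c + multiplicity (int p) b"
    using assms c d by (simp add: prime_elem_multiplicity_mult_distrib)
  then have "int (multiplicity (int p) d) - int (multiplicity (int p) c)
      = int (multiplicity (int p) b) - int (multiplicity (int p) a)" by linarith
  then show ?thesis using assms unfolding padic_abs_def q by simp
qed

lemma padic_abs_0 [simp]: "padic_abs p 0 = 0"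
  by (simp add: padic_abs_def)

lemma padic_abs_eq_0_iff [simp]: "padic_abs p x = 0 \<longleftrightarrow> x = 0"
  using prime_gt_0_nat[OF p] by (simp add: padic_abs_def)

lemma padic_abs_nonneg [simp]: "0 \<le> padic_abs p x"
  by (simp add: padic_abs_def)

lemma padic_abs_1 [simp]: "padic_abs p 1 = 1"
  by (simp add: padic_abs_def)

lemma rat_common_denom:
  obtains a b c :: int where "c \<noteq> 0" "(x::rat) = of_int a / of_int c" "(y::rat) = of_int b / of_int c"
proof -
  obtain a c where 1: "x = of_int a / of_int c" "c > 0"
    by (metis quotient_of_denom_pos quotient_of_div surj_pair)
  obtain b d where 2: "y = of_int b / of_int d" "d > 0"
    by (metis quotient_of_denom_pos quotient_of_div surj_pair)
  show ?thesis
    by (rule that[of "c * d" "a * d" "b * c"]) (use 1 2 in auto)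
qed

lemma padic_abs_mult [simp]: "padic_abs p (x * y) = padic_abs p x * padic_abs p y"
proof (cases "x = 0 \<or> y = 0")
  case False
  obtain a b c where c: "c \<noteq> 0" and x: "x = of_int a / of_int c" and y: "y = of_int b / of_int c"
    by (rule rat_common_denom)
  have "prime_elem (int p)" using p by simp
  moreover have ab: "a \<noteq> 0" "b \<noteq> 0" using False x y by auto
  moreover have "x * y = of_int (a * b) / of_int (c * c)" using x y by simp
  moreover have "real p \<noteq> 0" using prime_gt_0_nat[OF p] by simp
  ultimately show ?thesis
    using c x y padic_abs_frac[of "a * b" "c * c"] padic_abs_frac[of a c] padic_abs_frac[of b c]
    by (simp add: prime_elem_multiplicity_mult_distrib power_int_add[symmetric] algebra_simps)
qed auto

lemma padic_abs_minus [simp]: "padic_abs p (- x) = padic_abs p x"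
proof -
  have "padic_abs p (-1) = 1" using padic_abs_frac[of "-1" 1]
    by (simp add: multiplicity_unit_right)
  then show ?thesis using padic_abs_mult[of "-1" x] by simp
qed

lemma padic_abs_minus_commute: "padic_abs p (x - y) = padic_abs p (y - x)"
  using padic_abs_minus[of "x - y"] by simp

lemma padic_abs_inverse [simp]: "padic_abs p (inverse x) = inverse (padic_abs p x)"
proof (cases "x = 0")
  case False
  then have "padic_abs p x * padic_abs p (inverse x) = 1"
    using padic_abs_mult[of x "inverse x"] by simp
  then show ?thesis by (metis inverse_unique)
qed auto

lemma padic_abs_ultrametric: "padic_abs p (x + y) \<le> max (padic_abs p x) (padic_abs p y)"
proof (cases "x = 0 \<or> y = 0 \<or> x + y = 0")
  case False
  obtain a b c where c: "c \<noteq> 0" and x: "x = of_int a / of_int c" and y: "y = of_int b / of_int c"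
    by (rule rat_common_denom)
  have xy: "x + y = of_int (a + b) / of_int c" using x y c by (simp add: add_divide_distrib)
  have ab: "a \<noteq> 0" "b \<noteq> 0" "a + b \<noteq> 0" using False x y xy by auto
  let ?m = "\<lambda>n. multiplicity (int p) n"
  have p1: "real p \<ge> 1" using prime_gt_0_nat[OF p] by simp
  have "\<not> is_unit (int p)" using p by auto
  then have "min (?m a) (?m b) \<le> ?m (a + b)"
    using ab by (intro multiplicity_geI dvd_add) (auto intro: multiplicity_dvd')
  then have "?m a \<le> ?m (a + b) \<or> ?m b \<le> ?m (a + b)" by linarith
  then have "padic_abs p (x + y) \<le> padic_abs p x \<or> padic_abs p (x + y) \<le> padic_abs p y"
    unfolding xy unfolding x y using ab c p1
    by (auto simp: padic_abs_frac simp del: of_int_add intro!: power_int_increasing)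
  then show ?thesis by auto
qed (auto simp: max_def)

lemma padic_abs_triangle: "padic_abs p (x + y) \<le> padic_abs p x + padic_abs p y"
  using padic_abs_ultrametric[of x y] padic_abs_nonneg[of x] padic_abs_nonneg[of y] by linarith

lemma padic_abs_triangle2: "\<bar>padic_abs p x - padic_abs p y\<bar> \<le> padic_abs p (x - y)"
  using padic_abs_triangle[of "x - y" y] padic_abs_triangle[of "y - x" x]
    padic_abs_minus_commute[of x y] by simp

end


section \<open>Null sequences and Cauchy sequences for the p-adic absolute value\<close>

definition padic_vanishes :: "nat \<Rightarrow> (nat \<Rightarrow> rat) \<Rightarrow> bool" where
  "padic_vanishes p X \<longleftrightarrow> (\<lambda>n. padic_abs p (X n)) \<longlonglongrightarrow> 0"

definition padic_cauchy :: "nat \<Rightarrow> (nat \<Rightarrow> rat) \<Rightarrow> bool" where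
  "padic_cauchy p X \<longleftrightarrow> (\<forall>e>0. \<exists>k. \<forall>m\<ge>k. \<forall>n\<ge>k. padic_abs p (X m - X n) < e)"

context
  fixes p :: nat
  assumes p: "prime p"
begin

lemma padic_vanishes_0 [simp]: "padic_vanishes p (\<lambda>n. 0)"
  using p by (simp add: padic_vanishes_def)

lemma padic_vanishes_minus: "padic_vanishes p X \<Longrightarrow> padic_vanishes p (\<lambda>n. - X n)"
  using p by (simp add: padic_vanishes_def)

lemma padic_vanishes_add:
  assumes "padic_vanishes p X" "padic_vanishes p Y"
  shows "padic_vanishes p (\<lambda>n. X n + Y n)"
proof -
  have "(\<lambda>n. padic_abs p (X n) + padic_abs p (Y n)) \<longlonglongrightarrow> 0"
    using tendsto_add[OF assms[unfolded padic_vanishes_def]] by simp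
  then show ?thesis unfolding padic_vanishes_def
    by (rule Lim_null_comparison[rotated])
      (use p padic_abs_triangle[OF p] in auto)
qed

lemma padic_vanishes_diff:
  assumes "padic_vanishes p X" "padic_vanishes p Y"
  shows "padic_vanishes p (\<lambda>n. X n - Y n)"
  using padic_vanishes_add[OF assms(1) padic_vanishes_minus[OF assms(2)]] by simp

lemma padic_cauchy_const [simp]: "padic_cauchy p (\<lambda>n. c)"
  using p by (simp add: padic_cauchy_def)

lemma padic_cauchy_minus [simp]:
  assumes "padic_cauchy p X"
  shows "padic_cauchy p (\<lambda>n. - X n)"
proof -
  have "padic_abs p (- X m - - X n) = padic_abs p (X m - X n)" for m n
    using padic_abs_minus[OF p, of "X m - X n"] by simp
  then show ?thesis using assms by (simp only: padic_cauchy_def)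
qed

lemma padic_cauchy_add [simp]:
  assumes "padic_cauchy p X" "padic_cauchy p Y"
  shows "padic_cauchy p (\<lambda>n. X n + Y n)"
  unfolding padic_cauchy_def
proof (intro allI impI)
  fix e :: real assume e: "e > 0"
  obtain i where i: "\<And>m n. m \<ge> i \<Longrightarrow> n \<ge> i \<Longrightarrow> padic_abs p (X m - X n) < e"
    using assms(1) e unfolding padic_cauchy_def by meson
  obtain j where j: "\<And>m n. m \<ge> j \<Longrightarrow> n \<ge> j \<Longrightarrow> padic_abs p (Y m - Y n) < e"
    using assms(2) e unfolding padic_cauchy_def by meson
  have "padic_abs p ((X m + Y m) - (X n + Y n)) < e" if "m \<ge> max i j" "n \<ge> max i j" for m n
  proof -
    have "padic_abs p ((X m + Y m) - (X n + Y n))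
        \<le> max (padic_abs p (X m - X n)) (padic_abs p (Y m - Y n))"
      unfolding add_diff_add by (rule padic_abs_ultrametric[OF p])
    then show ?thesis using i[of m n] j[of m n] that by linarith
  qed
  then show "\<exists>k. \<forall>m\<ge>k. \<forall>n\<ge>k. padic_abs p ((X m + Y m) - (X n + Y n)) < e" by blast
qed

lemma padic_cauchy_diff:
  "padic_cauchy p X \<Longrightarrow> padic_cauchy p Y \<Longrightarrow> padic_cauchy p (\<lambda>n. X n - Y n)"
  using padic_cauchy_add[OF _ padic_cauchy_minus] by simp

lemma padic_cauchy_abs_convergent:
  assumes "padic_cauchy p X"
  shows "convergent (\<lambda>n. padic_abs p (X n))"
proof -
  have "Cauchy (\<lambda>n. padic_abs p (X n))"
    unfolding Cauchy_def dist_real_def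
  proof (intro allI impI)
    fix e :: real assume "e > 0"
    then obtain k where "\<forall>m\<ge>k. \<forall>n\<ge>k. padic_abs p (X m - X n) < e"
      using assms unfolding padic_cauchy_def by meson
    then show "\<exists>M. \<forall>m\<ge>M. \<forall>n\<ge>M. \<bar>padic_abs p (X m) - padic_abs p (X n)\<bar> < e"
      by (meson padic_abs_triangle2[OF p] le_less_trans)
  qed
  then show ?thesis by (rule Cauchy_convergent)
qed

lemma padic_cauchy_imp_bounded:
  assumes "padic_cauchy p X"
  obtains b where "b > 0" "\<And>n. padic_abs p (X n) < b"
proof -
  have "Bseq (\<lambda>n. padic_abs p (X n))"
    using padic_cauchy_abs_convergent[OF assms] by (rule convergent_imp_Bseq)
  then obtain K where K: "K > 0" "\<And>n. \<bar>padic_abs p (X n)\<bar> \<le> K"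
    by (auto simp: Bseq_def)
  have "padic_abs p (X n) < K + 1" for n
    using K(2)[of n] by linarith
  then show ?thesis using K(1) that[of "K + 1"] by simp
qed

lemma padic_vanishes_mult_cauchy:
  assumes "padic_cauchy p X" "padic_vanishes p Y"
  shows "padic_vanishes p (\<lambda>n. X n * Y n)"
proof -
  obtain b where b: "b > 0" "\<And>n. padic_abs p (X n) < b"
    using padic_cauchy_imp_bounded[OF assms(1)] by blast
  have "(\<lambda>n. b * padic_abs p (Y n)) \<longlonglongrightarrow> 0"
    using tendsto_mult_left[OF assms(2)[unfolded padic_vanishes_def], of b] by simp
  then show ?thesis unfolding padic_vanishes_def
    by (rule Lim_null_comparison[rotated])
      (use p less_imp_le[OF b(2)] in \<open>auto intro!: mult_right_mono always_eventually\<close>)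
qed

lemma padic_cauchy_mult [simp]:
  assumes X: "padic_cauchy p X" and Y: "padic_cauchy p Y"
  shows "padic_cauchy p (\<lambda>n. X n * Y n)"
  unfolding padic_cauchy_def
proof (intro allI impI)
  fix e :: real assume e: "e > 0"
  obtain a where a: "a > 0" "\<And>n. padic_abs p (X n) < a"
    using padic_cauchy_imp_bounded[OF X] by blast
  obtain b where b: "b > 0" "\<And>n. padic_abs p (Y n) < b"
    using padic_cauchy_imp_bounded[OF Y] by blast
  obtain i where i: "\<And>m n. m \<ge> i \<Longrightarrow> n \<ge> i \<Longrightarrow> padic_abs p (X m - X n) < e / b"
    using X e b(1) unfolding padic_cauchy_def by (meson divide_pos_pos)
  obtain j where j: "\<And>m n. m \<ge> j \<Longrightarrow> n \<ge> j \<Longrightarrow> padic_abs p (Y m - Y n) < e / a"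
    using Y e a(1) unfolding padic_cauchy_def by (meson divide_pos_pos)
  have "padic_abs p (X m * Y m - X n * Y n) < e" if "m \<ge> max i j" "n \<ge> max i j" for m n
  proof -
    have "padic_abs p (X m * Y m - X n * Y n)
        \<le> max (padic_abs p (X m) * padic_abs p (Y m - Y n))
              (padic_abs p (X m - X n) * padic_abs p (Y n))"
      unfolding mult_diff_mult padic_abs_mult[OF p, symmetric]
      by (rule padic_abs_ultrametric[OF p])
    moreover have "padic_abs p (X m) * padic_abs p (Y m - Y n) < a * (e / a)"
      by (rule mult_strict_mono') (use a j that p in auto)
    moreover have "padic_abs p (X m - X n) * padic_abs p (Y n) < (e / b) * b"
      by (rule mult_strict_mono') (use b i that p in auto)
    ultimately show ?thesis using a(1) b(1) by simp
  qed
  then show "\<exists>k. \<forall>m\<ge>k. \<forall>n\<ge>k. padic_abs p (X m * Y m - X n * Y n) < e" by blast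
qed

lemma padic_cauchy_not_vanishes:
  assumes X: "padic_cauchy p X" and nz: "\<not> padic_vanishes p X"
  obtains b k where "b > 0" "\<And>n. n \<ge> k \<Longrightarrow> b < padic_abs p (X n)"
proof -
  obtain L where L: "(\<lambda>n. padic_abs p (X n)) \<longlonglongrightarrow> L"
    using padic_cauchy_abs_convergent[OF X] by (auto simp: convergent_def)
  have "L \<ge> 0" by (rule LIMSEQ_le_const[OF L]) (use p in auto)
  moreover have "L \<noteq> 0" using L nz by (auto simp: padic_vanishes_def)
  ultimately have "L / 2 > 0" "L / 2 < L" by auto
  moreover obtain k where "\<And>n. n \<ge> k \<Longrightarrow> L / 2 < padic_abs p (X n)"
    using order_tendstoD(1)[OF L \<open>L / 2 < L\<close>] by (auto simp: eventually_sequentially)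
  ultimately show ?thesis using that by blast
qed

lemma padic_cauchy_inverse [simp]:
  assumes X: "padic_cauchy p X" and nz: "\<not> padic_vanishes p X"
  shows "padic_cauchy p (\<lambda>n. inverse (X n))"
  unfolding padic_cauchy_def
proof (intro allI impI)
  fix e :: real assume e: "e > 0"
  obtain b i where b: "b > 0" and i: "\<And>n. n \<ge> i \<Longrightarrow> b < padic_abs p (X n)"
    using padic_cauchy_not_vanishes[OF X nz] by blast
  obtain j where j: "\<And>m n. m \<ge> j \<Longrightarrow> n \<ge> j \<Longrightarrow> padic_abs p (X m - X n) < b * e * b"
    using X e b unfolding padic_cauchy_def by (meson mult_pos_pos)
  have "padic_abs p (inverse (X m) - inverse (X n)) < e" if mn: "m \<ge> max i j" "n \<ge> max i j" for m n
  proof -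
    have bm: "b < padic_abs p (X m)" and bn: "b < padic_abs p (X n)" using i mn by auto
    then have "X m \<noteq> 0" "X n \<noteq> 0" using b p by auto
    then have "padic_abs p (inverse (X m) - inverse (X n))
        = inverse (padic_abs p (X m)) * padic_abs p (X m - X n) * inverse (padic_abs p (X n))"
      using p by (simp add: inverse_diff_inverse)
    also have "\<dots> < inverse b * (b * e * b) * inverse b"
      by (intro mult_strict_mono' less_imp_inverse_less bm bn b j mult_nonneg_nonneg)
        (use mn p in auto)
    also have "\<dots> = e" using b by simp
    finally show ?thesis .
  qed
  then show "\<exists>k. \<forall>m\<ge>k. \<forall>n\<ge>k. padic_abs p (inverse (X m) - inverse (X n)) < e" by blast
qed

lemma padic_vanishes_diff_inverse:
  assumes X: "padic_cauchy p X" "\<not> padic_vanishes p X"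
    and Y: "padic_cauchy p Y" "\<not> padic_vanishes p Y"
    and XY: "padic_vanishes p (\<lambda>n. X n - Y n)"
  shows "padic_vanishes p (\<lambda>n. inverse (X n) - inverse (Y n))"
proof -
  have "padic_cauchy p (\<lambda>n. - inverse (X n) * inverse (Y n))"
    using padic_cauchy_minus[OF padic_cauchy_mult[OF padic_cauchy_inverse[OF X] padic_cauchy_inverse[OF Y]]]
    by simp
  then have v: "padic_vanishes p (\<lambda>n. - inverse (X n) * inverse (Y n) * (X n - Y n))"
    using XY by (rule padic_vanishes_mult_cauchy)
  obtain a i where a: "a > 0" and i: "\<And>n. n \<ge> i \<Longrightarrow> a < padic_abs p (X n)"
    using padic_cauchy_not_vanishes[OF X] by blast
  obtain b j where b: "b > 0" and j: "\<And>n. n \<ge> j \<Longrightarrow> b < padic_abs p (Y n)"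
    using padic_cauchy_not_vanishes[OF Y] by blast
  have "\<forall>\<^sub>F n in sequentially. padic_abs p (- inverse (X n) * inverse (Y n) * (X n - Y n))
          = padic_abs p (inverse (X n) - inverse (Y n))"
    using eventually_ge_at_top[of "max i j"]
  proof eventually_elim
    case (elim n)
    then have "X n \<noteq> 0" "Y n \<noteq> 0" using i[of n] j[of n] a b p by auto
    then have "- inverse (X n) * inverse (Y n) * (X n - Y n) = inverse (X n) - inverse (Y n)"
      by (simp add: field_simps)
    then show ?case by simp
  qed
  from tendsto_cong[OF this] show ?thesis
    using v by (simp only: padic_vanishes_def)
qed

end


section \<open>The field of p-adic numbers\<close>

text \<open>
  The prime is a type parameter: \<open>'p padic\<close> is the field of \<open>CARD('p)\<close>-adic numbers, constructed
  as the ring of Cauchy sequences of rationals with respect to \<open>padic_abs CARD('p)\<close> modulo the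
  ideal of null sequences.
\<close>

typedef (overloaded) ('p::prime_card) padic_seq = "{X. padic_cauchy CARD('p) X}"
  using padic_cauchy_const[OF prime_card] by auto

setup_lifting type_definition_padic_seq

instantiation padic_seq :: (prime_card) comm_ring_1
begin

lift_definition zero_padic_seq :: "'a padic_seq" is "\<lambda>n. 0"
  by (simp add: prime_card)

lift_definition one_padic_seq :: "'a padic_seq" is "\<lambda>n. 1"
  by (simp add: prime_card)

lift_definition plus_padic_seq :: "'a padic_seq \<Rightarrow> 'a padic_seq \<Rightarrow> 'a padic_seq"
  is "\<lambda>X Y n. X n + Y n"
  by (simp add: prime_card)

lift_definition uminus_padic_seq :: "'a padic_seq \<Rightarrow> 'a padic_seq" is "\<lambda>X n. - X n"
  by (simp add: prime_card)

lift_definition minus_padic_seq :: "'a padic_seq \<Rightarrow> 'a padic_seq \<Rightarrow> 'a padic_seq"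
  is "\<lambda>X Y n. X n - Y n"
  by (simp add: prime_card padic_cauchy_diff)

lift_definition times_padic_seq :: "'a padic_seq \<Rightarrow> 'a padic_seq \<Rightarrow> 'a padic_seq"
  is "\<lambda>X Y n. X n * Y n"
  by (simp add: prime_card)

instance
proof
  show "(0::'a padic_seq) \<noteq> 1" by transfer (simp add: fun_eq_iff)
qed (transfer; simp add: algebra_simps)+

end

lift_definition null_seq :: "'p::prime_card padic_seq \<Rightarrow> bool" is "padic_vanishes CARD('p)" .

lemma null_seq_0: "null_seq 0"
  by transfer (simp add: prime_card)

lemma null_seq_add: "null_seq X \<Longrightarrow> null_seq Y \<Longrightarrow> null_seq (X + Y)"
  by transfer (simp add: prime_card padic_vanishes_add)

lemma null_seq_minus: "null_seq X \<Longrightarrow> null_seq (- X)"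
  by transfer (simp add: prime_card padic_vanishes_minus)

lemma null_seq_mult: "null_seq Y \<Longrightarrow> null_seq (X * Y)"
  by transfer (simp add: prime_card padic_vanishes_mult_cauchy)

definition padic_rel :: "'p::prime_card padic_seq \<Rightarrow> 'p padic_seq \<Rightarrow> bool" where
  "padic_rel X Y \<longleftrightarrow> null_seq (X - Y)"

lemma equivp_padic_rel: "equivp (padic_rel :: 'p::prime_card padic_seq \<Rightarrow> _)"
proof (rule equivpI)
  show "reflp (padic_rel :: 'p padic_seq \<Rightarrow> _)"
    by (simp add: reflp_def padic_rel_def null_seq_0)
  show "symp (padic_rel :: 'p padic_seq \<Rightarrow> _)"
  proof (rule sympI)
    fix X Y :: "'p padic_seq"
    assume "padic_rel X Y"
    then show "padic_rel Y X"
      using null_seq_minus[of "X - Y"] by (simp add: padic_rel_def)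
  qed
  show "transp (padic_rel :: 'p padic_seq \<Rightarrow> _)"
  proof (rule transpI)
    fix X Y Z :: "'p padic_seq"
    assume "padic_rel X Y" "padic_rel Y Z"
    then show "padic_rel X Z"
      using null_seq_add[of "X - Y" "Y - Z"] by (simp add: padic_rel_def)
  qed
qed

quotient_type (overloaded) 'p padic = "'p::prime_card padic_seq" / padic_rel
  by (rule equivp_padic_rel)

lift_definition seq_inverse :: "'p::prime_card padic_seq \<Rightarrow> 'p padic_seq"
  is "\<lambda>X. if padic_vanishes CARD('p) X then (\<lambda>n. 0) else (\<lambda>n. inverse (X n))"
  by (simp add: prime_card)

lemma seq_inverse_null: "null_seq X \<Longrightarrow> seq_inverse X = 0"
  by transfer simp

lemma seq_inverse_diff:
  "\<not> null_seq X \<Longrightarrow> \<not> null_seq Y \<Longrightarrow> null_seq (X - Y) \<Longrightarrow> null_seq (seq_inverse X - seq_inverse Y)"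
  by transfer (simp add: prime_card padic_vanishes_diff_inverse)

lemma seq_inverse_mult: "\<not> null_seq X \<Longrightarrow> null_seq (seq_inverse X * X - 1)"
proof (transfer, goal_cases)
  case (1 X)
  obtain b k where b: "b > 0" "\<And>n. n \<ge> k \<Longrightarrow> b < padic_abs CARD('a) (X n)"
    using padic_cauchy_not_vanishes[OF prime_card 1] by blast
  have "\<forall>\<^sub>F n in sequentially. padic_abs CARD('a) (inverse (X n) * X n - 1) = 0"
    using eventually_ge_at_top[of k]
  proof eventually_elim
    case (elim n)
    then have "X n \<noteq> 0" using b(1) b(2)[of n] by (auto simp: prime_card)
    then show ?case by (simp add: prime_card)
  qed
  then show ?case using 1 by (simp add: padic_vanishes_def tendsto_eventually)
qed

instantiation padic :: (prime_card) field
begin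

lift_definition zero_padic :: "'a padic" is 0 .

lift_definition one_padic :: "'a padic" is 1 .

lift_definition plus_padic :: "'a padic \<Rightarrow> 'a padic \<Rightarrow> 'a padic" is "(+)"
  unfolding padic_rel_def add_diff_add by (rule null_seq_add)

lift_definition uminus_padic :: "'a padic \<Rightarrow> 'a padic" is uminus
  unfolding padic_rel_def minus_diff_minus by (rule null_seq_minus)

lift_definition minus_padic :: "'a padic \<Rightarrow> 'a padic \<Rightarrow> 'a padic" is "(-)"
proof -
  fix X X' Y Y' :: "'a padic_seq"
  assume "padic_rel X X'" "padic_rel Y Y'"
  then have "null_seq ((X - X') + - (Y - Y'))"
    unfolding padic_rel_def by (intro null_seq_add null_seq_minus)
  then show "padic_rel (X - Y) (X' - Y')" by (simp add: padic_rel_def algebra_simps)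
qed

lift_definition times_padic :: "'a padic \<Rightarrow> 'a padic \<Rightarrow> 'a padic" is "(*)"
proof -
  fix X X' Y Y' :: "'a padic_seq"
  assume "padic_rel X X'" "padic_rel Y Y'"
  then have "null_seq (X * (Y - Y') + Y' * (X - X'))"
    unfolding padic_rel_def by (intro null_seq_add null_seq_mult)
  then show "padic_rel (X * Y) (X' * Y')" by (simp add: padic_rel_def algebra_simps)
qed

lift_definition inverse_padic :: "'a padic \<Rightarrow> 'a padic" is seq_inverse
proof -
  fix X Y :: "'a padic_seq"
  assume XY: "padic_rel X Y"
  then have "null_seq X \<longleftrightarrow> null_seq Y"
    unfolding padic_rel_def
    using null_seq_add[of "X - Y" Y] null_seq_add[of "- (X - Y)" X] null_seq_minus[of "X - Y"] by auto
  then show "padic_rel (seq_inverse X) (seq_inverse Y)"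
    using XY unfolding padic_rel_def
    by (cases "null_seq X") (auto simp: seq_inverse_null null_seq_0 seq_inverse_diff)
qed

definition divide_padic :: "'a padic \<Rightarrow> 'a padic \<Rightarrow> 'a padic" where
  "divide_padic x y = x * inverse y"

instance
proof
  fix a b c :: "'a padic"
  show "a + b = b + a"
    by transfer (simp add: ac_simps padic_rel_def null_seq_0)
  show "(a + b) + c = a + (b + c)"
    by transfer (simp add: ac_simps padic_rel_def null_seq_0)
  show "0 + a = a"
    by transfer (simp add: padic_rel_def null_seq_0)
  show "- a + a = 0"
    by transfer (simp add: padic_rel_def null_seq_0)
  show "a - b = a + - b"
    by transfer (simp add: padic_rel_def null_seq_0)
  show "(a * b) * c = a * (b * c)"
    by transfer (simp add: ac_simps padic_rel_def null_seq_0)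
  show "a * b = b * a"
    by transfer (simp add: ac_simps padic_rel_def null_seq_0)
  show "1 * a = a"
    by transfer (simp add: padic_rel_def null_seq_0)
  show "(a + b) * c = a * c + b * c"
    by transfer (simp add: distrib_right padic_rel_def null_seq_0)
  show "(0::'a padic) \<noteq> 1"
    by (transfer, unfold padic_rel_def, transfer) (simp add: padic_vanishes_def prime_card LIMSEQ_const_iff)
  show "a \<noteq> 0 \<Longrightarrow> inverse a * a = 1"
    by transfer (simp add: padic_rel_def seq_inverse_mult)
  show "a div b = a * inverse b"
    by (rule divide_padic_def)
  show "inverse (0::'a padic) = 0"
    by transfer (simp add: padic_rel_def seq_inverse_null null_seq_0)
qed

end


section \<open>The p-adic norm, metric and topology\<close>

lift_definition seq_norm :: "'p::prime_card padic_seq \<Rightarrow> real"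
  is "\<lambda>X. lim (\<lambda>n. padic_abs CARD('p) (X n))" .

lemma seq_norm_LIMSEQ: "(\<lambda>n. padic_abs CARD('p) (Rep_padic_seq X n)) \<longlonglongrightarrow> seq_norm (X::'p::prime_card padic_seq)"
  by transfer (simp add: padic_cauchy_abs_convergent[OF prime_card] convergent_LIMSEQ_iff[symmetric])

lift_definition padic_norm :: "'p::prime_card padic \<Rightarrow> real" is seq_norm
proof -
  fix X Y :: "'p padic_seq"
  assume "padic_rel X Y"
  then have v: "(\<lambda>n. padic_abs CARD('p) (Rep_padic_seq X n - Rep_padic_seq Y n)) \<longlonglongrightarrow> 0"
    by (simp add: padic_rel_def null_seq.rep_eq minus_padic_seq.rep_eq padic_vanishes_def)
  have "(\<lambda>n. padic_abs CARD('p) (Rep_padic_seq X n) - padic_abs CARD('p) (Rep_padic_seq Y n)) \<longlonglongrightarrow> 0"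
    by (rule Lim_null_comparison[OF _ v]) (simp add: padic_abs_triangle2 prime_card)
  moreover have "(\<lambda>n. padic_abs CARD('p) (Rep_padic_seq X n) - padic_abs CARD('p) (Rep_padic_seq Y n))
      \<longlonglongrightarrow> seq_norm X - seq_norm Y"
    by (intro tendsto_diff seq_norm_LIMSEQ)
  ultimately show "seq_norm X = seq_norm Y" using LIMSEQ_unique by fastforce
qed

lemma padic_norm_eq_0_iff [simp]: "padic_norm x = 0 \<longleftrightarrow> x = 0"
proof (transfer, unfold padic_rel_def, simp, goal_cases)
  case (1 X)
  show ?case using seq_norm_LIMSEQ[of X] LIMSEQ_unique
    by (auto simp: null_seq.rep_eq padic_vanishes_def)
qed

lemma padic_norm_0 [simp]: "padic_norm 0 = 0"
  by simp

lemma padic_norm_nonneg [simp]: "0 \<le> padic_norm x"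
  by transfer (rule LIMSEQ_le_const[OF seq_norm_LIMSEQ], simp add: prime_card)

lemma padic_norm_mult: "padic_norm (x * y) = padic_norm x * padic_norm y"
proof (transfer, goal_cases)
  case (1 X Y)
  show ?case
    using seq_norm_LIMSEQ[of "X * Y"] tendsto_mult[OF seq_norm_LIMSEQ[of X] seq_norm_LIMSEQ[of Y]]
    by (simp add: times_padic_seq.rep_eq prime_card LIMSEQ_unique)
qed

lemma padic_norm_minus [simp]: "padic_norm (- x) = padic_norm x"
proof (transfer, goal_cases)
  case (1 X)
  show ?case
    using seq_norm_LIMSEQ[of "- X"] seq_norm_LIMSEQ[of X]
    by (simp add: uminus_padic_seq.rep_eq prime_card LIMSEQ_unique)
qed

lemma padic_norm_ultrametric: "padic_norm (x + y) \<le> max (padic_norm x) (padic_norm y)"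
proof (transfer, goal_cases)
  case (1 X Y)
  show ?case
    by (rule LIMSEQ_le[OF seq_norm_LIMSEQ[of "X + Y"] tendsto_max[OF seq_norm_LIMSEQ[of X] seq_norm_LIMSEQ[of Y]]])
      (simp add: plus_padic_seq.rep_eq prime_card padic_abs_ultrametric)
qed

instantiation padic :: (prime_card) metric_space
begin

definition dist_padic :: "'a padic \<Rightarrow> 'a padic \<Rightarrow> real" where
  "dist_padic x y = padic_norm (x - y)"

definition uniformity_padic :: "('a padic \<times> 'a padic) filter" where
  "uniformity_padic = (INF e\<in>{0 <..}. principal {(x, y). dist x y < e})"

definition open_padic :: "'a padic set \<Rightarrow> bool" where
  "open_padic U \<longleftrightarrow> (\<forall>x\<in>U. \<forall>\<^sub>F (x', y) in uniformity. x' = x \<longrightarrow> y \<in> U)"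

instance
proof
  fix x y z :: "'a padic"
  show "dist x y = 0 \<longleftrightarrow> x = y" by (simp add: dist_padic_def)
  have "padic_norm (x - y) \<le> max (padic_norm (x - z)) (padic_norm (y - z))"
    using padic_norm_ultrametric[of "x - z" "- (y - z)"] unfolding padic_norm_minus by simp
  then show "dist x y \<le> dist x z + dist y z"
    using padic_norm_nonneg[of "x - z"] padic_norm_nonneg[of "y - z"]
    unfolding dist_padic_def by linarith
qed (simp_all only: uniformity_padic_def open_padic_def)

end


lemma abs_padic_of_nat: "of_nat n = abs_padic (of_nat n :: 'p::prime_card padic_seq)"
  by (induction n) (simp_all add: zero_padic.abs_eq one_padic.abs_eq plus_padic.abs_eq)

lemma Rep_padic_seq_of_nat: "Rep_padic_seq (of_nat n :: 'p::prime_card padic_seq) k = of_nat n"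
  by (induction n) (simp_all add: zero_padic_seq.rep_eq one_padic_seq.rep_eq plus_padic_seq.rep_eq)

lemma padic_norm_of_nat:
  "padic_norm (of_nat n :: 'p::prime_card padic) = padic_abs CARD('p) (of_nat n)"
  using seq_norm_LIMSEQ[of "of_nat n :: 'p padic_seq"]
  by (simp add: abs_padic_of_nat padic_norm.abs_eq Rep_padic_seq_of_nat LIMSEQ_const_iff)

instance padic :: (prime_card) field_char_0
proof
  show "inj (of_nat :: nat \<Rightarrow> 'a padic)"
  proof (rule injI)
    have *: "m = n" if "m \<le> n" "(of_nat m :: 'a padic) = of_nat n" for m n
    proof -
      have "(of_nat (n - m) :: 'a padic) = 0" using that by (simp add: of_nat_diff)
      then have "padic_abs CARD('a) (of_nat (n - m)) = 0"
        by (metis padic_norm_of_nat padic_norm_0)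
      then have "n - m = 0" by (simp add: prime_card del: of_nat_diff)
      then show ?thesis using that by simp
    qed
    fix m n :: nat
    assume "(of_nat m :: 'a padic) = of_nat n"
    then show "m = n" using *[of m n] *[of n m] by (cases "m \<le> n") auto
  qed
qed

lift_definition seq_const :: "rat \<Rightarrow> 'p::prime_card padic_seq" is "\<lambda>r n. r"
  by (simp add: prime_card)

lemma abs_padic_of_int: "of_int k = abs_padic (seq_const (of_int k) :: 'p::prime_card padic_seq)"
proof -
  have nat: "seq_const (of_nat n) = (of_nat n :: 'p padic_seq)" for n
    by (simp add: Rep_padic_seq_inject[symmetric] fun_eq_iff Rep_padic_seq_of_nat seq_const.rep_eq)
  have neg: "seq_const (- r) = (- seq_const r :: 'p padic_seq)" for r
    by transfer simp
  show ?thesis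
    by (cases k rule: int_cases2) (simp_all add: nat neg abs_padic_of_nat uminus_padic.abs_eq)
qed

lemma of_rat_padic: "of_rat r = abs_padic (seq_const r :: 'p::prime_card padic_seq)"
proof -
  obtain a b where r: "r = of_int a / of_int b" "b > 0"
    by (metis quotient_of_denom_pos quotient_of_div surj_pair)
  have "(seq_const r * seq_const (of_int b) :: 'p padic_seq) = seq_const (of_int a)"
    using r by transfer simp
  then have "abs_padic (seq_const r :: 'p padic_seq) * of_int b = of_int a"
    by (simp add: abs_padic_of_int times_padic.abs_eq)
  then have "abs_padic (seq_const r :: 'p padic_seq) = of_int a / of_int b"
    using r(2) by (simp add: eq_divide_eq)
  then show ?thesis unfolding r(1) by (simp add: of_rat_divide)
qed

text \<open>
  Together, \<open>padic_norm_of_rat\<close>, \<open>of_rat_dense\<close> and the \<open>complete_space\<close> instance below say that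
  \<open>'p padic\<close> is the completion of the rationals for the \<open>CARD('p)\<close>-adic absolute value.
\<close>

lemma padic_norm_of_rat:
  "padic_norm (of_rat r :: 'p::prime_card padic) = padic_abs CARD('p) r"
  using seq_norm_LIMSEQ[of "seq_const r :: 'p padic_seq"]
  by (simp add: of_rat_padic padic_norm.abs_eq seq_const.rep_eq LIMSEQ_const_iff)

lemma dist_abs_padic_of_rat_le:
  fixes X :: "'p::prime_card padic_seq"
  assumes "\<And>n. n \<ge> k \<Longrightarrow> padic_abs CARD('p) (Rep_padic_seq X n - r) \<le> e"
  shows "dist (abs_padic X) (of_rat r) \<le> e"
proof -
  have "dist (abs_padic X) (of_rat r) = seq_norm (X - seq_const r)"
    by (simp add: dist_padic_def of_rat_padic minus_padic.abs_eq padic_norm.abs_eq)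
  also have "\<dots> \<le> e"
    by (rule LIMSEQ_le_const2[OF seq_norm_LIMSEQ])
      (use assms in \<open>auto simp: minus_padic_seq.rep_eq seq_const.rep_eq\<close>)
  finally show ?thesis .
qed

lemma of_rat_dense:
  fixes x :: "'p::prime_card padic"
  assumes "e > 0"
  shows "\<exists>r. dist x (of_rat r) < e"
proof -
  obtain X where x: "x = abs_padic X"
    using Quotient_abs_rep[OF Quotient_padic] by metis
  have "padic_cauchy CARD('p) (Rep_padic_seq X)" using Rep_padic_seq[of X] by simp
  then obtain k where k: "\<And>m n. m \<ge> k \<Longrightarrow> n \<ge> k \<Longrightarrow>
      padic_abs CARD('p) (Rep_padic_seq X m - Rep_padic_seq X n) < e / 2"
    using assms unfolding padic_cauchy_def by (meson half_gt_zero)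
  have "dist x (of_rat (Rep_padic_seq X k)) \<le> e / 2"
    unfolding x by (rule dist_abs_padic_of_rat_le[of k]) (rule less_imp_le, rule k, simp_all)
  then show ?thesis using assms by (intro exI[of _ "Rep_padic_seq X k"]) simp
qed

instance padic :: (prime_card) complete_space
proof
  fix S :: "nat \<Rightarrow> 'a padic"
  assume S: "Cauchy S"
  have "\<exists>r. dist (S n) (of_rat r) < inverse (real (Suc n))" for n
    by (rule of_rat_dense) simp
  then obtain r where r: "\<And>n. dist (S n) (of_rat (r n)) < inverse (real (Suc n))"
    by metis
  have "norm (dist (S n) (of_rat (r n))) \<le> inverse (real (Suc n))" for n
    using r[of n] by (simp del: of_nat_Suc)
  then have "(\<lambda>n. dist (S n) (of_rat (r n))) \<longlonglongrightarrow> 0"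
    by (intro Lim_null_comparison[OF always_eventually LIMSEQ_inverse_real_of_nat] allI)
  then have d: "\<forall>\<^sub>F n in sequentially. dist (S n) (of_rat (r n)) < e" if "e > 0" for e
    using that by (auto dest: order_tendstoD)
  have cauchy: "\<exists>k. \<forall>m\<ge>k. \<forall>n\<ge>k. dist (S m) (S n) < e / 3 \<and> dist (S n) (of_rat (r n)) < e / 3
      \<and> padic_abs CARD('a) (r m - r n) < e" if e: "e > 0" for e
  proof -
    obtain i where i: "\<And>m n. m \<ge> i \<Longrightarrow> n \<ge> i \<Longrightarrow> dist (S m) (S n) < e / 3"
      using S e unfolding Cauchy_def by (meson zero_less_divide_iff zero_less_numeral)
    obtain j where j: "\<And>n. n \<ge> j \<Longrightarrow> dist (S n) (of_rat (r n)) < e / 3"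
      using d[of "e / 3"] e by (auto simp: eventually_sequentially)
    have "padic_abs CARD('a) (r m - r n) < e" if "m \<ge> max i j" "n \<ge> max i j" for m n
    proof -
      have "padic_abs CARD('a) (r m - r n) = dist (of_rat (r m) :: 'a padic) (of_rat (r n))"
        by (simp add: dist_padic_def padic_norm_of_rat[symmetric] of_rat_diff)
      also have "\<dots> \<le> dist (S m) (of_rat (r m)) + dist (S m) (S n) + dist (S n) (of_rat (r n))"
        using dist_triangle[of "of_rat (r m)" "of_rat (r n)" "S m"] dist_triangle[of "S m" "of_rat (r n)" "S n"]
        by (simp add: dist_commute)
      also have "\<dots> < e" using i[of m n] j[of m] j[of n] that by simp
      finally show ?thesis .
    qed
    then show ?thesis using i j by (intro exI[of _ "max i j"]) auto
  qed
  have "padic_cauchy CARD('a) r"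
    unfolding padic_cauchy_def using cauchy by meson
  then obtain X :: "'a padic_seq" where X: "Rep_padic_seq X = r"
    by (metis Abs_padic_seq_inverse mem_Collect_eq)
  have "S \<longlonglongrightarrow> abs_padic X"
  proof (rule metric_LIMSEQ_I)
    fix e :: real assume e: "e > 0"
    obtain k where k: "\<And>m n. m \<ge> k \<Longrightarrow> n \<ge> k \<Longrightarrow> dist (S n) (of_rat (r n)) < e / 2 / 3
        \<and> padic_abs CARD('a) (r m - r n) < e / 2"
      using cauchy[of "e / 2"] e by (meson half_gt_zero)
    have "dist (S n) (abs_padic X) < e" if n: "n \<ge> k" for n
    proof -
      have "dist (abs_padic X) (of_rat (r n)) \<le> e / 2"
        by (rule dist_abs_padic_of_rat_le[of k]) (use k n X in \<open>auto intro: less_imp_le\<close>)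
      moreover have "dist (S n) (of_rat (r n)) < e / 2 / 3" using k n by blast
      ultimately show ?thesis
        using dist_triangle2[of "S n" "abs_padic X" "of_rat (r n)"] e by simp
    qed
    then show "\<exists>no. \<forall>n\<ge>no. dist (S n) (abs_padic X) < e" by blast
  qed
  then show "convergent S" by (auto simp: convergent_def)
qed


section \<open>Analytic functions and multiplicities of zeros\<close>

definition Zp :: "'p::prime_card padic set" where
  "Zp = {x. padic_norm x \<le> 1}"

text \<open>
  A function on \<open>Zp\<close> is represented by a function on the whole field of which only the
  values on \<open>Zp\<close> matter. It is analytic if it is the sum of one power series that converges
  everywhere on \<open>Zp\<close>; the centre is irrelevant, so it is taken to be \<open>0\<close>.
\<close>

definition analytic_on_Zp :: "('p::prime_card padic \<Rightarrow> 'p padic) \<Rightarrow> bool" where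
  "analytic_on_Zp f \<longleftrightarrow> (\<exists>c. \<forall>x\<in>Zp. (\<lambda>n. c n * x ^ n) sums f x)"

definition zero_of_multiplicity :: "('p::prime_card padic \<Rightarrow> 'p padic) \<Rightarrow> 'p padic \<Rightarrow> nat \<Rightarrow> bool" where
  "zero_of_multiplicity f z \<mu> \<longleftrightarrow>
     z \<in> Zp \<and> \<mu> \<ge> 1 \<and>
     (\<exists>g. analytic_on_Zp g \<and> g z \<noteq> 0 \<and> (\<forall>x\<in>Zp. f x = (x - z) ^ \<mu> * g x))"

definition quotient_set :: "('p::prime_card padic \<Rightarrow> 'p padic) \<Rightarrow> 'p padic set" where
  "quotient_set f =
     {f (of_nat a) / f (of_nat b) | a b :: nat. a > 0 \<and> b > 0 \<and> f (of_nat b) \<noteq> 0}"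

end

theory Submission
  imports Defs
begin

text \<open>
  Put \<open>f x = (x - z1) ^ \<mu>1 * g1 x = (x - z2) ^ \<mu>2 * g2 x\<close>. For a target \<open>y \<noteq> 0\<close> let
  \<open>w = y * g2 z2 / g1 z1\<close> and choose \<open>u\<close>, \<open>v\<close> with \<open>\<mu>1 * u = \<mu>2 * v + 1\<close>. Then
  \<open>t = w ^ u * r ^ \<mu>2\<close> and \<open>s = w ^ v * r ^ \<mu>1\<close> satisfy \<open>t ^ \<mu>1 = w * s ^ \<mu>2\<close> exactly, so
  \<open>f (z1 + t) / f (z2 + s) = w * g1 (z1 + t) / g2 (z2 + s)\<close>, which tends to \<open>y\<close> as
  \<open>r = p ^ n\<close> tends to \<open>0\<close>. Since \<open>f\<close> is continuous and the positive integers are dense in \<open>Zp\<close>,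
  each of these quotients is in turn a limit of elements of \<open>quotient_set f\<close>.
\<close>

section \<open>The p-adic numbers as a topological field\<close>

lemma padic_norm_1 [simp]: "padic_norm (1 :: 'p::prime_card padic) = 1"
  using padic_norm_of_nat[of 1, where 'p = 'p] by (simp add: prime_card)

lemma padic_norm_power: "padic_norm (x ^ n) = padic_norm x ^ n"
  by (induction n) (simp_all add: padic_norm_mult)

lemma padic_norm_inverse: "padic_norm (inverse x) = inverse (padic_norm x)"
proof (cases "x = 0")
  case False
  then have "padic_norm x * padic_norm (inverse x) = 1"
    by (simp add: padic_norm_mult[symmetric])
  then show ?thesis by (metis inverse_unique)
qed simp

lemma padic_norm_diff_le: "padic_norm (x - y) \<le> max (padic_norm x) (padic_norm y)"
  using padic_norm_ultrametric[of x "- y"] by simp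

lemma padic_norm_add_le: "padic_norm (x + y) \<le> padic_norm x + padic_norm y"
  using padic_norm_ultrametric[of x y] padic_norm_nonneg[of x] padic_norm_nonneg[of y] by linarith

text \<open>By the ultrametric inequality a bound on the terms is a bound on the sum, whatever the
  number of terms. The condition \<open>0 \<le> B\<close> covers the sums that are \<open>0\<close>
  by convention.\<close>

lemma padic_norm_sum_le:
  assumes "\<And>i. i \<in> A \<Longrightarrow> padic_norm (h i) \<le> B" "0 \<le> B"
  shows "padic_norm (sum h A) \<le> B"
  using assms
proof (induction A rule: infinite_finite_induct)
  case (insert i A)
  then have "padic_norm (h i) \<le> B" "padic_norm (sum h A) \<le> B" by auto
  then show ?case
    using insert(1,2) padic_norm_ultrametric[of "h i" "sum h A"] by simp
qed auto

lemma tendsto_padic_iff: "(f \<longlongrightarrow> l) F \<longleftrightarrow> ((\<lambda>x. padic_norm (f x - l)) \<longlongrightarrow> 0) F"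
  by (subst tendsto_dist_iff) (simp add: dist_padic_def)

lemma tendsto_padic_le:
  assumes "(g \<longlongrightarrow> 0) F" "\<And>x. padic_norm (f x - l) \<le> g x"
  shows "(f \<longlongrightarrow> l) F"
  unfolding tendsto_padic_iff
  by (rule Lim_null_comparison[OF _ assms(1)]) (simp add: assms(2))

text \<open>This instance and the next one make the general rules \<open>tendsto_add\<close>,
  \<open>tendsto_diff\<close> and \<open>tendsto_mult\<close> available for p-adic limits.\<close>

instance padic :: (prime_card) topological_group_add
proof
  fix a b :: "'a padic"
  have f: "((\<lambda>x. padic_norm (fst x - a)) \<longlongrightarrow> 0) (nhds a \<times>\<^sub>F nhds b)"
    unfolding tendsto_padic_iff[symmetric] by (rule filterlim_fst)
  have s: "((\<lambda>x. padic_norm (snd x - b)) \<longlongrightarrow> 0) (nhds a \<times>\<^sub>F nhds b)"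
    unfolding tendsto_padic_iff[symmetric] by (rule filterlim_snd)
  show "((\<lambda>x. fst x + snd x) \<longlongrightarrow> a + b) (nhds a \<times>\<^sub>F nhds b)"
    by (rule tendsto_padic_le[OF tendsto_add[OF f s, simplified]])
      (simp add: add_diff_add padic_norm_add_le)
  have "(\<lambda>x. padic_norm (- x - - a)) = (\<lambda>x. padic_norm (x - a))"
    by (metis minus_diff_minus padic_norm_minus)
  moreover have "((\<lambda>x. padic_norm (x - a)) \<longlongrightarrow> 0) (nhds a)"
    unfolding tendsto_padic_iff[symmetric] by (rule filterlim_ident)
  ultimately show "(uminus \<longlongrightarrow> - a) (nhds a)"
    unfolding tendsto_padic_iff[of uminus] by simp
qed

instance padic :: (prime_card) topological_semigroup_mult
proof
  fix a b :: "'a padic"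
  have f: "((\<lambda>x. padic_norm (fst x - a)) \<longlongrightarrow> 0) (nhds a \<times>\<^sub>F nhds b)"
    unfolding tendsto_padic_iff[symmetric] by (rule filterlim_fst)
  have s: "((\<lambda>x. padic_norm (snd x - b)) \<longlongrightarrow> 0) (nhds a \<times>\<^sub>F nhds b)"
    unfolding tendsto_padic_iff[symmetric] by (rule filterlim_snd)
  have lim: "((\<lambda>x. padic_norm (fst x - a) * padic_norm (snd x - b)
      + (padic_norm (fst x - a) * padic_norm b + padic_norm a * padic_norm (snd x - b)))
      \<longlongrightarrow> 0 * 0 + (0 * padic_norm b + padic_norm a * 0)) (nhds a \<times>\<^sub>F nhds b)"
    by (intro tendsto_intros f s)
  have le: "padic_norm (x * y - a * b) \<le> padic_norm (x - a) * padic_norm (y - b)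
      + (padic_norm (x - a) * padic_norm b + padic_norm a * padic_norm (y - b))" for x y
  proof -
    \<comment> \<open>Expanding around \<open>(a, b)\<close> leaves in every summand a factor that
      tends to \<open>0\<close>.\<close>
    have "x * y - a * b = (x - a) * (y - b) + ((x - a) * b + a * (y - b))"
      by (simp add: algebra_simps)
    then show ?thesis
      using padic_norm_add_le[of "(x - a) * (y - b)" "(x - a) * b + a * (y - b)"]
        padic_norm_add_le[of "(x - a) * b" "a * (y - b)"]
      by (simp add: padic_norm_mult)
  qed
  show "((\<lambda>x. fst x * snd x) \<longlongrightarrow> a * b) (nhds a \<times>\<^sub>F nhds b)"
    by (rule tendsto_padic_le[OF lim[simplified]]) (rule le)
qed

lemma tendsto_padic_norm:
  assumes "(f \<longlongrightarrow> l) F"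
  shows "((\<lambda>x. padic_norm (f x)) \<longlongrightarrow> padic_norm l) F"
  using tendsto_dist[OF assms tendsto_const[of 0]] by (simp add: dist_padic_def)

text \<open>Since \<open>l \<noteq> 0\<close>, eventually \<open>f x \<noteq> 0\<close>. Then the
  two inverses differ, up to sign, by \<open>(f x - l) / (f x * l)\<close>, and only limits of real
  norms remain.\<close>

lemma tendsto_inverse_padic:
  fixes l :: "'p::prime_card padic"
  assumes f: "(f \<longlongrightarrow> l) F" and l: "l \<noteq> 0"
  shows "((\<lambda>x. inverse (f x)) \<longlongrightarrow> inverse l) F"
proof -
  have "((\<lambda>x. padic_norm (f x - l) * inverse (padic_norm (f x)) * inverse (padic_norm l))
      \<longlongrightarrow> 0 * inverse (padic_norm l) * inverse (padic_norm l)) F"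
    by (intro tendsto_mult tendsto_inverse tendsto_const tendsto_padic_norm f
        f[unfolded tendsto_padic_iff]) (use l in auto)
  then have lim: "((\<lambda>x. padic_norm (f x - l) * inverse (padic_norm (f x)) * inverse (padic_norm l))
      \<longlongrightarrow> 0) F" by simp
  show ?thesis unfolding tendsto_padic_iff
  proof (rule Lim_null_comparison[OF _ lim])
    show "\<forall>\<^sub>F x in F. norm (padic_norm (inverse (f x) - inverse l))
        \<le> padic_norm (f x - l) * inverse (padic_norm (f x)) * inverse (padic_norm l)"
      using tendsto_imp_eventually_ne[OF f l]
    proof eventually_elim
      case (elim x)
      have "inverse (f x) - inverse l = - ((f x - l) * inverse (f x) * inverse l)"
        using elim l by (simp add: field_simps)
      then show ?case by (simp add: padic_norm_mult padic_norm_inverse)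
    qed
  qed
qed

lemma tendsto_divide_padic:
  fixes l :: "'p::prime_card padic"
  assumes "(f \<longlongrightarrow> k) F" "(g \<longlongrightarrow> l) F" "l \<noteq> 0"
  shows "((\<lambda>x. f x / g x) \<longlongrightarrow> k / l) F"
  unfolding divide_padic_def by (intro tendsto_mult tendsto_inverse_padic assms)

lemma LIMSEQ_padic_power_zero:
  assumes "padic_norm q < 1"
  shows "(\<lambda>n. q ^ n) \<longlonglongrightarrow> 0"
  unfolding tendsto_padic_iff
  using assms by (simp add: padic_norm_power LIMSEQ_power_zero)

lemma padic_norm_CARD: "padic_norm (of_nat CARD('p) :: 'p::prime_card padic) = inverse (real CARD('p))"
proof -
  have p: "prime CARD('p)" by (rule prime_card)
  then have "padic_abs CARD('p) (of_nat CARD('p)) = real CARD('p) powi (- 1)"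
    using padic_abs_frac[OF p, of "int CARD('p)" 1] multiplicity_prime[of "int CARD('p)"]
      prime_gt_0_nat[OF p] by simp
  then show ?thesis by (simp add: padic_norm_of_nat)
qed

lemma padic_norm_CARD_power_less_1:
  assumes "m > 0"
  shows "padic_norm (of_nat CARD('p) ^ m :: 'p::prime_card padic) < 1"
  using assms prime_gt_1_nat[OF prime_card, where 'a1 = 'p]
  by (simp add: padic_norm_power padic_norm_CARD power_less_one_iff inverse_less_1_iff)

section \<open>Density of the positive integers in the p-adic integers\<close>

lemma Zp_add: "x \<in> Zp \<Longrightarrow> y \<in> Zp \<Longrightarrow> x + y \<in> Zp"
  using padic_norm_ultrametric[of x y] by (auto simp: Zp_def)

lemma of_nat_in_Zp: "(of_nat n :: 'p::prime_card padic) \<in> Zp"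
proof (induction n)
  case (Suc n)
  have "(1 :: 'p padic) \<in> Zp" by (simp add: Zp_def)
  then show ?case using Zp_add[OF _ Suc] by simp
qed (simp add: Zp_def)

lemma of_int_in_Zp: "(of_int n :: 'p::prime_card padic) \<in> Zp"
  by (cases n rule: int_cases2) (use of_nat_in_Zp[where 'p = 'p] in \<open>auto simp: Zp_def\<close>)

lemma padic_norm_of_int_frac:
  assumes "a \<noteq> 0" "b \<noteq> 0"
  shows "padic_norm (of_int a / of_int b :: 'p::prime_card padic)
    = real CARD('p) powi (int (multiplicity (int CARD('p)) b) - int (multiplicity (int CARD('p)) a))"
  using padic_norm_of_rat[of "of_int a / of_int b", where 'p = 'p] padic_abs_frac[OF prime_card assms]
  by (simp add: of_rat_divide)

text \<open>If the prime divided the denominator, it would not divide the coprime numerator, and the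
  norm of the fraction would be a positive power of the prime, hence above \<open>1\<close>.\<close>

lemma rat_in_Zp_denominator:
  assumes ab: "coprime a b" "b \<noteq> 0"
    and Zp: "(of_int a / of_int b :: 'p::prime_card padic) \<in> Zp"
  shows "\<not> int CARD('p) dvd b"
proof
  let ?p = "int CARD('p)"
  assume dvd: "?p dvd b"
  have p: "prime ?p" by (rule prime_card_int)
  have "\<not> ?p dvd a"
    using coprime_common_divisor[OF ab(1) _ dvd] p not_prime_unit by blast
  then have "a \<noteq> 0" "multiplicity ?p a = 0" by (auto simp: not_dvd_imp_multiplicity_0)
  moreover have "multiplicity ?p b > 0"
    using dvd ab(2) p by (simp add: prime_multiplicity_gt_zero_iff)
  moreover have "1 < real CARD('p)" using prime_gt_1_nat[OF prime_card, where 'a1 = 'p] by simp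
  ultimately have "1 < padic_norm (of_int a / of_int b :: 'p padic)"
    using padic_norm_of_int_frac[of a b, where 'p = 'p] ab(2) by simp
  then show False using Zp by (simp add: Zp_def)
qed

text \<open>A rational \<open>a / b\<close> close to \<open>x\<close> has denominator prime to
  \<open>CARD('p)\<close>, so the congruence \<open>b * n = a\<close> modulo a high power of the
  prime has a solution \<open>n\<close>, which is then close to \<open>a / b\<close>.\<close>

lemma nat_dense_Zp:
  fixes x :: "'p::prime_card padic"
  assumes x: "x \<in> Zp" and e: "e > 0"
  shows "\<exists>n>0. dist x (of_nat n) < e"
proof -
  let ?p = "int CARD('p)"
  have p: "prime ?p" by (rule prime_card_int)
  have p1: "1 < real CARD('p)" using prime_gt_1_nat[OF prime_card, where 'a1 = 'p] by simp
  obtain k where k: "inverse (real CARD('p)) ^ k < e"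
    using real_arch_pow_inv[OF e, of "inverse (real CARD('p))"] p1
    by (auto simp: inverse_less_1_iff)
  \<comment> \<open>The bound \<open>1\<close> forces \<open>r\<close> into \<open>Zp\<close> by the
    ultrametric inequality, so that its denominator is a p-adic unit.\<close>
  obtain r where r: "dist x (of_rat r) < min e 1"
    using of_rat_dense[of "min e 1" x] e by auto
  obtain a b where q: "quotient_of r = (a, b)" by fastforce
  have b: "b > 0" "coprime a b" using quotient_of_denom_pos[OF q] quotient_of_coprime[OF q] by auto
  have rq: "(of_rat r :: 'p padic) = of_int a / of_int b"
    by (simp add: quotient_of_div[OF q] of_rat_divide)
  have "(of_rat r :: 'p padic) = x - (x - of_rat r)" by simp
  then have "padic_norm (of_rat r :: 'p padic) \<le> 1"
    using padic_norm_diff_le[of x "x - of_rat r"] x r by (simp add: dist_padic_def Zp_def max_def split: if_splits)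
  then have ndvd: "\<not> ?p dvd b"
    using rat_in_Zp_denominator[of a b, where 'p = 'p] b by (simp add: rq Zp_def)
  have normb: "padic_norm (of_int b :: 'p padic) = 1"
    using padic_norm_of_int_frac[of b 1, where 'p = 'p] ndvd b(1)
    by (simp add: not_dvd_imp_multiplicity_0)
  have "coprime b (?p ^ k)"
    using prime_imp_coprime[OF p ndvd] by (simp add: coprime_commute)
  then obtain c where c: "[b * c = 1] (mod ?p ^ k)"
    using cong_solve_coprime_int by blast
  \<comment> \<open>As \<open>c\<close> inverts \<open>b\<close> modulo \<open>?p ^ k\<close>, the
    residue of \<open>a * c\<close> solves the congruence. The added power keeps the residue and
    makes \<open>n\<close> positive.\<close>
  define n where "n = nat ((a * c) mod ?p ^ k) + CARD('p) ^ k"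
  have pk: "?p ^ k > 0" using p1 by simp
  then have "int n = (a * c) mod ?p ^ k + ?p ^ k" by (simp add: n_def)
  then have "[int n = a * c] (mod ?p ^ k)" by (simp add: cong_def)
  then have "[b * int n = a * (b * c)] (mod ?p ^ k)"
    using cong_scalar_left[of "int n" "a * c" "?p ^ k" b] by (simp add: ac_simps)
  also have "[a * (b * c) = a] (mod ?p ^ k)"
    using cong_scalar_left[OF c, of a] by simp
  finally obtain d where d: "b * int n - a = ?p ^ k * d"
    by (auto simp: cong_iff_dvd_diff)
  \<comment> \<open>The numerator is \<open>?p ^ k * d\<close>. With \<open>b\<close> of norm
    \<open>1\<close> and \<open>d\<close> of norm at most \<open>1\<close>, the quotient has norm at
    most that of \<open>?p ^ k\<close>.\<close>
  have "of_nat n - (of_rat r :: 'p padic) = of_int (b * int n - a) / of_int b"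
    using b(1) by (simp add: rq field_simps)
  then have "of_nat n - (of_rat r :: 'p padic) = of_nat CARD('p) ^ k * of_int d / of_int b"
    unfolding d by simp
  then have "padic_norm (of_nat n - (of_rat r :: 'p padic))
      = inverse (real CARD('p)) ^ k * padic_norm (of_int d :: 'p padic)"
    by (simp add: divide_padic_def padic_norm_mult padic_norm_inverse padic_norm_power
        padic_norm_CARD normb)
  also have "\<dots> \<le> inverse (real CARD('p)) ^ k * 1"
    using of_int_in_Zp[of d, where 'p = 'p] by (intro mult_left_mono) (simp_all add: Zp_def)
  finally have "padic_norm (of_nat n - (of_rat r :: 'p padic)) < e" using k by simp
  then have "dist x (of_nat n) < e"
    using padic_norm_diff_le[of "x - of_rat r" "of_nat n - of_rat r"] r
    by (simp add: dist_padic_def max_def split: if_splits)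
  moreover have "n > 0" using p1 by (simp add: n_def)
  ultimately show ?thesis by blast
qed

lemma nat_seq_tendsto_Zp:
  fixes x :: "'p::prime_card padic"
  assumes "x \<in> Zp"
  obtains a :: "nat \<Rightarrow> nat" where "\<And>n. a n > 0" "(\<lambda>n. of_nat (a n)) \<longlonglongrightarrow> x"
proof -
  have "\<exists>m>0. dist x (of_nat m) < inverse (real (Suc n))" for n
    by (rule nat_dense_Zp[OF assms]) simp
  then obtain a where a: "\<And>n. a n > 0" "\<And>n. dist x (of_nat (a n)) < inverse (real (Suc n))"
    by metis
  have "(\<lambda>n. of_nat (a n)) \<longlonglongrightarrow> x"
    by (rule tendsto_padic_le[OF LIMSEQ_inverse_real_of_nat])
      (use a(2) in \<open>simp add: dist_padic_def[symmetric] dist_commute less_imp_le\<close>)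
  then show ?thesis using that a(1) by blast
qed

section \<open>Continuity of analytic functions\<close>

text \<open>All powers share the Lipschitz constant \<open>1\<close>, which makes the termwise
  estimate of a power series uniform in the degree.\<close>

lemma padic_norm_power_diff_le:
  assumes "x \<in> Zp" "y \<in> Zp"
  shows "padic_norm (x ^ n - y ^ n) \<le> padic_norm (x - y)"
proof (induction n)
  case (Suc n)
  have "x ^ Suc n - y ^ Suc n = x * (x ^ n - y ^ n) + (x - y) * y ^ n"
    by (simp add: algebra_simps)
  moreover have "padic_norm (x * (x ^ n - y ^ n)) \<le> 1 * padic_norm (x - y)"
    unfolding padic_norm_mult using assms Suc by (intro mult_mono) (auto simp: Zp_def)
  moreover have "padic_norm ((x - y) * y ^ n) \<le> padic_norm (x - y) * 1"
    unfolding padic_norm_mult padic_norm_power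
    using assms by (intro mult_left_mono power_le_one) (auto simp: Zp_def)
  ultimately show ?case
    using padic_norm_ultrametric[of "x * (x ^ n - y ^ n)" "(x - y) * y ^ n"] by simp
qed simp

lemma analytic_on_Zp_Lipschitz:
  assumes "analytic_on_Zp f"
  obtains M where "\<And>x y. x \<in> Zp \<Longrightarrow> y \<in> Zp \<Longrightarrow> padic_norm (f x - f y) \<le> M * padic_norm (x - y)"
proof -
  obtain c where c: "\<And>x. x \<in> Zp \<Longrightarrow> (\<lambda>n. c n * x ^ n) sums f x"
    using assms unfolding analytic_on_Zp_def by blast
  \<comment> \<open>Convergence at the point \<open>1\<close> of \<open>Zp\<close> makes the
    coefficients a null sequence. Hence they are bounded, and their bound is the Lipschitz
    constant.\<close>
  have "(\<lambda>n. \<Sum>i<n. c i) \<longlonglongrightarrow> f 1"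
    using c[of 1] by (simp add: Zp_def sums_def)
  then have "(\<lambda>n. (\<Sum>i<Suc n. c i) - (\<Sum>i<n. c i)) \<longlonglongrightarrow> f 1 - f 1"
    by (intro tendsto_diff LIMSEQ_Suc)
  then have "c \<longlonglongrightarrow> 0" by simp
  then have "Bseq (\<lambda>n. padic_norm (c n))"
    using tendsto_padic_norm convergent_imp_Bseq convergentI by blast
  then obtain M where M: "M > 0" "\<And>n. padic_norm (c n) \<le> M"
    by (auto simp: Bseq_def)
  show thesis
  proof (rule that[of M])
    fix x y :: "'a padic"
    assume xy: "x \<in> Zp" "y \<in> Zp"
    have "(\<lambda>n. (\<Sum>i<n. c i * x ^ i) - (\<Sum>i<n. c i * y ^ i)) \<longlonglongrightarrow> f x - f y"
      using c[OF xy(1)] c[OF xy(2)] unfolding sums_def by (rule tendsto_diff)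
    then have lim: "(\<lambda>n. padic_norm (\<Sum>i<n. c i * (x ^ i - y ^ i))) \<longlonglongrightarrow> padic_norm (f x - f y)"
      by (intro tendsto_padic_norm) (simp add: sum_subtractf right_diff_distrib)
    have "padic_norm (\<Sum>i<n. c i * (x ^ i - y ^ i)) \<le> M * padic_norm (x - y)" for n
      using M xy by (intro padic_norm_sum_le)
        (auto simp: padic_norm_mult intro!: mult_mono padic_norm_power_diff_le)
    then show "padic_norm (f x - f y) \<le> M * padic_norm (x - y)"
      by (intro LIMSEQ_le_const2[OF lim]) blast
  qed
qed

lemma tendsto_analytic_on_Zp:
  assumes f: "analytic_on_Zp f" and x: "x \<in> Zp"
    and X: "X \<longlonglongrightarrow> x" "\<forall>\<^sub>F n in sequentially. X n \<in> Zp"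
  shows "(\<lambda>n. f (X n)) \<longlonglongrightarrow> f x"
proof -
  obtain M where M: "\<And>x y. x \<in> Zp \<Longrightarrow> y \<in> Zp \<Longrightarrow> padic_norm (f x - f y) \<le> M * padic_norm (x - y)"
    by (rule analytic_on_Zp_Lipschitz[OF f]) blast
  have lim: "(\<lambda>n. M * padic_norm (X n - x)) \<longlonglongrightarrow> 0"
    using tendsto_mult_right_zero X(1) unfolding tendsto_padic_iff by blast
  show ?thesis unfolding tendsto_padic_iff
    by (rule Lim_null_comparison[OF _ lim])
      (use X(2) in \<open>auto elim!: eventually_mono intro: M x\<close>)
qed

section \<open>Density of the quotient set\<close>

lemma LIMSEQ_in_closure:
  assumes "\<forall>\<^sub>F n in sequentially. X n \<in> closure S" "X \<longlonglongrightarrow> l"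
  shows "l \<in> closure S"
  by (rule Lim_in_closed_set[OF closed_closure assms(1) trivial_limit_sequentially assms(2)])

text \<open>Frees the later argument from integers: arbitrary points of \<open>Zp\<close> may serve
  as arguments. As \<open>f y \<noteq> 0\<close>, the approximating denominators are eventually
  nonzero.\<close>

lemma quotient_in_closure:
  assumes f: "analytic_on_Zp f" and xy: "x \<in> Zp" "y \<in> Zp" "f y \<noteq> 0"
  shows "f x / f y \<in> closure (quotient_set f)"
proof -
  obtain a where a: "\<And>n. a n > 0" "(\<lambda>n. of_nat (a n)) \<longlonglongrightarrow> x"
    using nat_seq_tendsto_Zp[OF xy(1)] by blast
  obtain b where b: "\<And>n. b n > 0" "(\<lambda>n. of_nat (b n)) \<longlonglongrightarrow> y"
    using nat_seq_tendsto_Zp[OF xy(2)] by blast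
  have fa: "(\<lambda>n. f (of_nat (a n))) \<longlonglongrightarrow> f x" and fb: "(\<lambda>n. f (of_nat (b n))) \<longlonglongrightarrow> f y"
    using tendsto_analytic_on_Zp[OF f xy(1) a(2)] tendsto_analytic_on_Zp[OF f xy(2) b(2)]
    by (simp_all add: of_nat_in_Zp)
  have "\<forall>\<^sub>F n in sequentially. f (of_nat (a n)) / f (of_nat (b n)) \<in> closure (quotient_set f)"
    using tendsto_imp_eventually_ne[OF fb xy(3)]
  proof eventually_elim
    case (elim n)
    then have "f (of_nat (a n)) / f (of_nat (b n)) \<in> quotient_set f"
      using a(1)[of n] b(1)[of n] by (auto simp: quotient_set_def)
    then show ?case using closure_subset by blast
  qed
  then show ?thesis
    by (rule LIMSEQ_in_closure) (rule tendsto_divide_padic[OF fa fb xy(3)])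
qed

text \<open>By the ultrametric inequality the open ball of radius \<open>1\<close> around a point of
  \<open>Zp\<close> stays inside \<open>Zp\<close>.\<close>

lemma tendsto_imp_eventually_in_Zp:
  assumes "(X \<longlongrightarrow> x) F" "x \<in> Zp"
  shows "\<forall>\<^sub>F n in F. X n \<in> Zp"
proof -
  have "\<forall>\<^sub>F n in F. dist (X n) x < 1" using assms(1) by (rule tendstoD) simp
  then show ?thesis
  proof eventually_elim
    case (elim n)
    then have "X n - x \<in> Zp" by (simp add: dist_padic_def Zp_def)
    then show ?case using Zp_add[OF _ assms(2)] by force
  qed
qed

lemma nonzero_in_closure_quotient_set:
  fixes f :: "'p::prime_card padic \<Rightarrow> 'p padic"
  assumes f: "analytic_on_Zp f"
    and z1: "zero_of_multiplicity f z1 \<mu>1"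
    and z2: "zero_of_multiplicity f z2 \<mu>2"
    and gcd: "gcd \<mu>1 \<mu>2 = 1"
    and y: "y \<noteq> 0"
  shows "y \<in> closure (quotient_set f)"
proof -
  obtain g1 where m1: "\<mu>1 \<ge> 1" "z1 \<in> Zp" and g1: "analytic_on_Zp g1" "g1 z1 \<noteq> 0"
      and f1: "\<And>x. x \<in> Zp \<Longrightarrow> f x = (x - z1) ^ \<mu>1 * g1 x"
    using z1 unfolding zero_of_multiplicity_def by blast
  obtain g2 where m2: "\<mu>2 \<ge> 1" "z2 \<in> Zp" and g2: "analytic_on_Zp g2" "g2 z2 \<noteq> 0"
      and f2: "\<And>x. x \<in> Zp \<Longrightarrow> f x = (x - z2) ^ \<mu>2 * g2 x"
    using z2 unfolding zero_of_multiplicity_def by blast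
  \<comment> \<open>A Bezout relation with natural coefficients; \<open>bezout_nat\<close> asks for
    \<open>\<mu>1\<close> to be nonzero.\<close>
  obtain u v where uv: "\<mu>1 * u = \<mu>2 * v + 1"
    using bezout_nat[of \<mu>1 \<mu>2] m1(1) gcd by auto
  \<comment> \<open>Chosen so that the limit \<open>w * (g1 z1 / g2 z2)\<close> equals
    \<open>y\<close>.\<close>
  define w where "w = y * g2 z2 / g1 z1"
  have w: "w \<noteq> 0" using y g1(2) g2(2) by (simp add: w_def)
  define p :: "'p padic" where "p = of_nat CARD('p)"
  have p: "p \<noteq> 0" by (simp add: p_def)
  \<comment> \<open>In \<open>t n ^ \<mu>1\<close> and \<open>s n ^ \<mu>2\<close> the powers of
    \<open>p\<close> agree, while by \<open>uv\<close> the powers of \<open>w\<close> differ by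
    exactly one factor \<open>w\<close>. Both sequences are geometric with a ratio of norm below
    \<open>1\<close>.\<close>
  define t where "t n = w ^ u * (p ^ \<mu>2) ^ n" for n
  define s where "s n = w ^ v * (p ^ \<mu>1) ^ n" for n
  have "t \<longlonglongrightarrow> w ^ u * 0" "s \<longlonglongrightarrow> w ^ v * 0"
    unfolding t_def s_def p_def using m1(1) m2(1)
    by (intro tendsto_mult tendsto_const LIMSEQ_padic_power_zero padic_norm_CARD_power_less_1; simp)+
  then have lim1: "(\<lambda>n. z1 + t n) \<longlonglongrightarrow> z1" and lim2: "(\<lambda>n. z2 + s n) \<longlonglongrightarrow> z2"
    using tendsto_add[OF tendsto_const, of t 0 sequentially z1]
      tendsto_add[OF tendsto_const, of s 0 sequentially z2] by auto
  \<comment> \<open>The norm of \<open>w\<close> may exceed \<open>1\<close>, so the points lie in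
    \<open>Zp\<close> only eventually, and only there do \<open>f1\<close> and \<open>f2\<close>
    apply.\<close>
  note Zp1 = tendsto_imp_eventually_in_Zp[OF lim1 m1(2)]
  note Zp2 = tendsto_imp_eventually_in_Zp[OF lim2 m2(2)]
  have limg1: "(\<lambda>n. g1 (z1 + t n)) \<longlonglongrightarrow> g1 z1" and limg2: "(\<lambda>n. g2 (z2 + s n)) \<longlonglongrightarrow> g2 z2"
    by (rule tendsto_analytic_on_Zp[OF g1(1) m1(2) lim1 Zp1]
        tendsto_analytic_on_Zp[OF g2(1) m2(2) lim2 Zp2])+
  have "t n ^ \<mu>1 = w ^ (\<mu>1 * u) * p ^ (\<mu>1 * \<mu>2 * n)" for n
    by (simp add: t_def power_mult_distrib power_mult[symmetric] ac_simps)
  moreover have "w * s n ^ \<mu>2 = w ^ (\<mu>2 * v + 1) * p ^ (\<mu>1 * \<mu>2 * n)" for n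
    by (simp add: s_def power_mult_distrib power_mult[symmetric] ac_simps)
  ultimately have ts: "t n ^ \<mu>1 = w * s n ^ \<mu>2" for n using uv by metis
  have s: "s n \<noteq> 0" for n using w p by (simp add: s_def)
  have "\<forall>\<^sub>F n in sequentially. w * (g1 (z1 + t n) / g2 (z2 + s n)) \<in> closure (quotient_set f)"
    using Zp1 Zp2 tendsto_imp_eventually_ne[OF limg2 g2(2)]
  proof eventually_elim
    case (elim n)
    have "f (z2 + s n) \<noteq> 0" using f2[OF elim(2)] elim(3) s by simp
    moreover have "f (z1 + t n) / f (z2 + s n) = w * (g1 (z1 + t n) / g2 (z2 + s n))"
      using f1[OF elim(1)] f2[OF elim(2)] s[of n] by (simp add: ts)
    ultimately show ?case using quotient_in_closure[OF f elim(1,2)] by simp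
  qed
  moreover have "(\<lambda>n. w * (g1 (z1 + t n) / g2 (z2 + s n))) \<longlonglongrightarrow> w * (g1 z1 / g2 z2)"
    by (intro tendsto_mult tendsto_const tendsto_divide_padic limg1 limg2 g2)
  ultimately have "w * (g1 z1 / g2 z2) \<in> closure (quotient_set f)"
    by (rule LIMSEQ_in_closure)
  moreover have "w * (g1 z1 / g2 z2) = y" using g1(2) g2(2) by (simp add: w_def)
  ultimately show ?thesis by simp
qed

theorem theorem1p2:
  fixes f :: "'p::prime_card padic \<Rightarrow> 'p padic"
    and z1 z2 :: "'p padic"
    and \<mu>1 \<mu>2 :: nat
  assumes "analytic_on_Zp f"
    and "zero_of_multiplicity f z1 \<mu>1"
    and "zero_of_multiplicity f z2 \<mu>2"
    and "gcd \<mu>1 \<mu>2 = 1"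
  shows "closure (quotient_set f) = UNIV"
proof -
  have nonzero: "y \<in> closure (quotient_set f)" if "y \<noteq> 0" for y
    using assms that by (rule nonzero_in_closure_quotient_set)
  \<comment> \<open>The target \<open>0\<close> is reached as a limit of the nonzero targets
    \<open>q ^ n\<close>, because a closure is closed.\<close>
  define q :: "'p padic" where "q = of_nat CARD('p)"
  have q: "(\<lambda>n. q ^ n) \<longlonglongrightarrow> 0"
    using LIMSEQ_padic_power_zero[OF padic_norm_CARD_power_less_1[of 1, where 'p = 'p]]
    by (simp add: q_def)
  have "\<forall>\<^sub>F n in sequentially. q ^ n \<in> closure (quotient_set f)"
    by (intro always_eventually allI nonzero) (simp add: q_def)
  then have "0 \<in> closure (quotient_set f)" using q by (rule LIMSEQ_in_closure)
  then have "y \<in> closure (quotient_set f)" for y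
    using nonzero by (cases "y = 0") simp_all
  then show ?thesis by blast
qed

end
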